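(* The slice algebraic subsets of $\mathbb{H}^n$ are the closed sets of a topology on $\mathbb{H}^n$.
   Context: $\mathbb{H}$ is the skew field of quaternions and $\mathbb{S}=\{q\in\mathbb{H}: q^2=-1\}$; for $K\in\mathbb{S}$, $\mathbb{C}_K=\mathbb{R}+\mathbb{R}K$ is identified with the complex plane. A subset $V\subseteq\mathbb{H}^n$ is called slice algebraic if for any $K\in\mathbb{S}$, $V\cap\mathbb{C}_K^n$ is a complex algebraic subset of $\mathbb{C}_K^n$ (the common zero set of a family of complex polynomials in $n$ variables over $\mathbb{C}_K$). *)

theory Defs
  imports "HOL-Analysis.Analysis" "HOL-Library.Poly_Mapping"
begin

section \<open>The skew field of quaternions\<close>

text \<open>The term \<open>Quat a b c d\<close> stands for \<open>a + b i + c j + d k\<close>.\<close>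

datatype quat = Quat (qRe: real) (qI: real) (qJ: real) (qK: real)

lemma quat_eq_iff:
  "p = q \<longleftrightarrow> qRe p = qRe q \<and> qI p = qI q \<and> qJ p = qJ q \<and> qK p = qK q"
  by (cases p; cases q) simp

instantiation quat :: ab_group_add
begin

definition "0 = Quat 0 0 0 0"
definition "p + q = Quat (qRe p + qRe q) (qI p + qI q) (qJ p + qJ q) (qK p + qK q)"
definition "- p = Quat (- qRe p) (- qI p) (- qJ p) (- qK p)"
definition "p - q = Quat (qRe p - qRe q) (qI p - qI q) (qJ p - qJ q) (qK p - qK q)"

instance
  by standard
    (simp_all add: quat_eq_iff zero_quat_def plus_quat_def uminus_quat_def minus_quat_def)

end

text \<open>Hamilton's product: \<open>i\<^sup>2 = j\<^sup>2 = k\<^sup>2 = -1\<close>, \<open>i j = k = - j i\<close>,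
  \<open>j k = i = - k j\<close>, \<open>k i = j = - i k\<close>.\<close>

instantiation quat :: real_algebra_1
begin

definition "1 = Quat 1 0 0 0"
definition "p * q = Quat
  (qRe p * qRe q - qI p * qI q - qJ p * qJ q - qK p * qK q)
  (qRe p * qI q + qI p * qRe q + qJ p * qK q - qK p * qJ q)
  (qRe p * qJ q - qI p * qK q + qJ p * qRe q + qK p * qI q)
  (qRe p * qK q + qI p * qJ q - qJ p * qI q + qK p * qRe q)"
definition "scaleR r p = Quat (r * qRe p) (r * qI p) (r * qJ p) (r * qK p)"

instance
  by standard
    (simp_all add: quat_eq_iff zero_quat_def plus_quat_def one_quat_def
      times_quat_def scaleR_quat_def algebra_simps)

end

text \<open>The inverse is the conjugate divided by the squared norm.\<close>

instantiation quat :: real_div_algebra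
begin

definition "inverse p =
  (let N = (qRe p)\<^sup>2 + (qI p)\<^sup>2 + (qJ p)\<^sup>2 + (qK p)\<^sup>2
   in Quat (qRe p / N) (- qI p / N) (- qJ p / N) (- qK p / N))"
definition "p div q = p * inverse q" for p q :: quat

instance
proof
  fix p q :: quat
  define N where "N = (qRe p)\<^sup>2 + (qI p)\<^sup>2 + (qJ p)\<^sup>2 + (qK p)\<^sup>2"
  have inv: "inverse p = Quat (qRe p / N) (- qI p / N) (- qJ p / N) (- qK p / N)"
    by (simp add: inverse_quat_def N_def Let_def)
  show "p div q = p * inverse q"
    by (rule divide_quat_def)
  show "inverse 0 = (0 :: quat)"
    by (simp add: inverse_quat_def zero_quat_def)
  assume "p \<noteq> 0"
  then have "N \<noteq> 0"
    unfolding N_def quat_eq_iff zero_quat_def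
    by (auto simp: add_nonneg_eq_0_iff)
  then have one: "(qRe p * qRe p + qI p * qI p + qJ p * qJ p + qK p * qK p) / N = 1"
    by (simp add: N_def power2_eq_square)
  show "inverse p * p = 1"
    using one by (simp add: inv quat_eq_iff times_quat_def one_quat_def add_divide_distrib)
  show "p * inverse p = 1"
    using one by (simp add: inv quat_eq_iff times_quat_def one_quat_def add_divide_distrib)
qed

end

section \<open>Slices\<close>

definition imag_units :: "quat set" where
  "imag_units = {q. q\<^sup>2 = - 1}"

text \<open>For \<open>K\<close> in \<open>imag_units\<close>, the identification \<open>x + y \<i> \<mapsto> x + y K\<close> of the complex
  plane with the slice \<open>\<real> + \<real> K\<close>.\<close>

definition of_complex_slice :: "quat \<Rightarrow> complex \<Rightarrow> quat" where
  "of_complex_slice K z = of_real (Re z) + of_real (Im z) * K"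

definition slice :: "quat \<Rightarrow> quat set" where
  "slice K = {of_real x + of_real y * K | x y. True}"

definition slice_vec :: "quat \<Rightarrow> (quat ^ 'n) set" where
  "slice_vec K = {q. \<forall>i. q $ i \<in> slice K}"

section \<open>Complex algebraic and slice algebraic sets\<close>

text \<open>Complex polynomials in variables indexed by \<open>'n\<close> are finitely supported families of
  coefficients, indexed by the exponent vectors \<open>'n \<Rightarrow>\<^sub>0 nat\<close>.\<close>

definition poly_eval :: "(('n::finite \<Rightarrow>\<^sub>0 nat) \<Rightarrow>\<^sub>0 complex) \<Rightarrow> complex ^ 'n \<Rightarrow> complex" where
  "poly_eval p z =
    (\<Sum>m\<in>Poly_Mapping.keys p. Poly_Mapping.lookup p m * (\<Prod>i\<in>UNIV. z $ i ^ Poly_Mapping.lookup m i))"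

definition complex_algebraic :: "(complex ^ 'n::finite) set \<Rightarrow> bool" where
  "complex_algebraic Z \<longleftrightarrow> (\<exists>P. Z = {z. \<forall>p\<in>P. poly_eval p z = 0})"

text \<open>A subset of the slice is algebraic when it corresponds to a complex algebraic set under the
  coordinatewise identification of the slice with \<open>complex ^ 'n\<close>.\<close>

definition slice_vec_algebraic :: "quat \<Rightarrow> (quat ^ 'n::finite) set \<Rightarrow> bool" where
  "slice_vec_algebraic K W \<longleftrightarrow>
    (\<exists>Z. complex_algebraic Z \<and> W = (\<lambda>z. \<chi> i. of_complex_slice K (z $ i)) ` Z)"

definition slice_algebraic :: "(quat ^ 'n::finite) set \<Rightarrow> bool" where
  "slice_algebraic V \<longleftrightarrow> (\<forall>K\<in>imag_units. slice_vec_algebraic K (V \<inter> slice_vec K))"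

end

theory Submission
  imports Defs
begin

text \<open>For each imaginary unit K, the map sending \<open>z\<close> to
  \<open>of_complex_slice K z\<close> in every coordinate is a bijection from complex n-space onto
  the slice \<open>slice_vec K\<close>. So V is slice algebraic iff its preimage under each of these
  maps is complex algebraic (\<open>slice_algebraic_iff_vimage\<close>). Preimages commute with
  unions and intersections, so the axioms for closed sets are inherited, one K at a time, from the
  Zariski topology. There the constant 1 has no zeros, products of polynomials cut out a union
  (\<open>complex_algebraic_Un\<close>, resting on \<open>poly_eval_mult\<close>), and pooling the
  equations cuts out an intersection (\<open>complex_algebraic_Inter\<close>).\<close>

lemma poly_eval_superset:
  assumes "finite A" "Poly_Mapping.keys p \<subseteq> A"
  shows "poly_eval p z =
    (\<Sum>m\<in>A. Poly_Mapping.lookup p m * (\<Prod>i\<in>UNIV. z $ i ^ Poly_Mapping.lookup m i))"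
  unfolding poly_eval_def using assms
  by (intro sum.mono_neutral_left) (auto simp: in_keys_iff)

lemma poly_eval_0 [simp]: "poly_eval 0 z = 0"
  by (simp add: poly_eval_def)

lemma poly_eval_1 [simp]: "poly_eval 1 z = 1"
  by (simp add: poly_eval_def)

lemma poly_eval_single:
  "poly_eval (Poly_Mapping.single m c) z = c * (\<Prod>i\<in>UNIV. z $ i ^ Poly_Mapping.lookup m i)"
  by (simp add: poly_eval_superset[of "{m}"])

lemma poly_eval_add: "poly_eval (p + q) z = poly_eval p z + poly_eval q z"
proof -
  let ?A = "Poly_Mapping.keys p \<union> Poly_Mapping.keys q"
  have "Poly_Mapping.keys (p + q) \<subseteq> ?A"
    by (rule Poly_Mapping.keys_add)
  then show ?thesis
    by (simp add: poly_eval_superset[of ?A] lookup_add distrib_right sum.distrib)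
qed

lemma poly_eval_sum: "poly_eval (sum f A) z = (\<Sum>a\<in>A. poly_eval (f a) z)"
  by (induction A rule: infinite_finite_induct) (simp_all add: poly_eval_add)

lemma poly_mapping_sum_single:
  "(\<Sum>m\<in>Poly_Mapping.keys p. Poly_Mapping.single m (Poly_Mapping.lookup p m)) = p"
  by (rule poly_mapping_eqI) (simp add: lookup_sum lookup_single when_def in_keys_iff)

text \<open>Both sides are biadditive in \<open>p\<close> and \<open>q\<close>, so expanding into
  monomials reduces the claim to single terms, where exponent vectors add and powers
  multiply.\<close>

lemma poly_eval_mult: "poly_eval (p * q) z = poly_eval p z * poly_eval q z"
proof -
  let ?t = "\<lambda>p m. Poly_Mapping.single m (Poly_Mapping.lookup p m)"
  have "p * q = (\<Sum>m\<in>Poly_Mapping.keys p. ?t p m) * (\<Sum>n\<in>Poly_Mapping.keys q. ?t q n)"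
    by (simp only: poly_mapping_sum_single)
  also have "poly_eval \<dots> z =
      (\<Sum>m\<in>Poly_Mapping.keys p. \<Sum>n\<in>Poly_Mapping.keys q.
        poly_eval (?t p m) z * poly_eval (?t q n) z)"
    by (simp add: sum_product mult_single poly_eval_sum poly_eval_single
        lookup_add power_add prod.distrib ac_simps)
  also have "\<dots> = poly_eval p z * poly_eval q z"
    by (simp add: sum_product poly_eval_single poly_eval_def[of p] poly_eval_def[of q])
  finally show ?thesis .
qed

lemma complex_algebraic_empty: "complex_algebraic {}"
  unfolding complex_algebraic_def by (rule exI[of _ "{1}"]) simp

lemma complex_algebraic_Un:
  assumes "complex_algebraic Y" "complex_algebraic Z"
  shows "complex_algebraic (Y \<union> Z)"
proof -
  obtain P Q where P: "Y = {z. \<forall>p\<in>P. poly_eval p z = 0}"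
    and Q: "Z = {z. \<forall>q\<in>Q. poly_eval q z = 0}"
    using assms unfolding complex_algebraic_def by blast
  define R where "R = {p * q | p q. p \<in> P \<and> q \<in> Q}"
  have "(\<forall>r\<in>R. poly_eval r z = 0) \<longleftrightarrow> (\<forall>p\<in>P. \<forall>q\<in>Q. poly_eval (p * q) z = 0)" for z
    unfolding R_def by blast
  then have "Y \<union> Z = {z. \<forall>r\<in>R. poly_eval r z = 0}"
    \<comment> \<open>If some \<open>p\<close> in \<open>P\<close> is nonzero at \<open>z\<close>,
      the vanishing of all products \<open>p * q\<close> forces every \<open>q\<close> in
      \<open>Q\<close> to vanish there.\<close>
    unfolding P Q poly_eval_mult mult_eq_0_iff by blast
  then show ?thesis
    unfolding complex_algebraic_def by blast
qed

text \<open>Choose defining equations for each member and impose them all at once. The empty family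
  is allowed and gives the whole space.\<close>

lemma complex_algebraic_Inter:
  assumes "\<And>Z. Z \<in> \<F> \<Longrightarrow> complex_algebraic Z"
  shows "complex_algebraic (\<Inter>\<F>)"
proof -
  have "\<forall>Z\<in>\<F>. \<exists>P. \<forall>z. z \<in> Z \<longleftrightarrow> (\<forall>p\<in>P. poly_eval p z = 0)"
    using assms by (force simp: complex_algebraic_def)
  from bchoice[OF this] obtain P
    where "\<forall>Z\<in>\<F>. \<forall>z. z \<in> Z \<longleftrightarrow> (\<forall>p\<in>P Z. poly_eval p z = 0)" ..
  then have "\<Inter>\<F> = {z. \<forall>p\<in>\<Union>(P ` \<F>). poly_eval p z = 0}"
    by auto
  then show ?thesis
    unfolding complex_algebraic_def by blast
qed

definition of_complex_slice_vec :: "quat \<Rightarrow> complex ^ 'n \<Rightarrow> quat ^ 'n" where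
  "of_complex_slice_vec K z = (\<chi> i. of_complex_slice K (z $ i))"

text \<open>A coincidence of two values gives an equation \<open>a = b * K\<close> with a and b
  real. Squaring eliminates K and leaves \<open>a^2 = - b^2\<close> over the reals, hence a = b =
  0.\<close>

lemma inj_of_complex_slice:
  assumes "K \<in> imag_units"
  shows "inj (of_complex_slice K)"
proof (rule injI)
  fix w z
  assume "of_complex_slice K w = of_complex_slice K z"
  then have eq: "of_real (Re w - Re z) = of_real (Im z - Im w) * K"
    by (simp add: of_complex_slice_def algebra_simps)
  have "of_real ((Re w - Re z)\<^sup>2) = (of_real (Im z - Im w) * K) ^ 2"
    by (simp only: of_real_power eq)
  also have "\<dots> = of_real ((Im z - Im w)\<^sup>2) * K\<^sup>2"
    \<comment> \<open>Real quaternions are central; writing them as scalars lets them move past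
      \<open>K\<close>.\<close>
    by (simp add: power2_eq_square scaleR_conv_of_real[symmetric] del: of_real_diff)
  also have "\<dots> = of_real (- (Im z - Im w)\<^sup>2)"
    using assms by (simp add: imag_units_def)
  finally have "(Re w - Re z)\<^sup>2 = - (Im z - Im w)\<^sup>2"
    by (simp only: of_real_eq_iff)
  then have "(Re w - Re z)\<^sup>2 + (Im z - Im w)\<^sup>2 = 0"
    by simp
  then show "w = z"
    by (simp add: sum_power2_eq_zero_iff complex_eq_iff)
qed

lemma inj_of_complex_slice_vec:
  assumes "K \<in> imag_units"
  shows "inj (of_complex_slice_vec K)"
  using inj_of_complex_slice[OF assms]
  by (auto simp: inj_def of_complex_slice_vec_def vec_eq_iff)

lemma range_of_complex_slice: "range (of_complex_slice K) = slice K"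
proof -
  have "of_real x + of_real y * K \<in> range (of_complex_slice K)" for x y
    by (rule range_eqI[of _ _ "Complex x y"]) (simp add: of_complex_slice_def)
  moreover have "of_complex_slice K z \<in> slice K" for z
    by (auto simp: slice_def of_complex_slice_def)
  ultimately show ?thesis
    by (auto simp: slice_def)
qed

lemma range_of_complex_slice_vec: "range (of_complex_slice_vec K) = slice_vec K"
proof
  show "range (of_complex_slice_vec K) \<subseteq> slice_vec K"
    by (auto simp: slice_vec_def of_complex_slice_vec_def simp flip: range_of_complex_slice)
  show "slice_vec K \<subseteq> range (of_complex_slice_vec K)"
  proof
    fix q :: "quat ^ 'n" assume "q \<in> slice_vec K"
    then have "\<forall>i. \<exists>z. q $ i = of_complex_slice K z"
      by (auto simp: slice_vec_def simp flip: range_of_complex_slice)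
    then obtain z where "\<forall>i. q $ i = of_complex_slice K (z i)"
      by metis
    then have "q = of_complex_slice_vec K (\<chi> i. z i)"
      by (simp add: of_complex_slice_vec_def vec_eq_iff)
    then show "q \<in> range (of_complex_slice_vec K)"
      by blast
  qed
qed

text \<open>Replaces the existential over images in \<open>slice_vec_algebraic\<close> by one
  explicit set: since the embedding is injective, the only \<open>Z\<close> with image
  \<open>V \<inter> slice_vec K\<close> is the preimage of \<open>V\<close>.\<close>

lemma slice_algebraic_iff_vimage:
  "slice_algebraic V \<longleftrightarrow>
    (\<forall>K\<in>imag_units. complex_algebraic (of_complex_slice_vec K -` V))"
proof -
  have "slice_vec_algebraic K (V \<inter> slice_vec K) \<longleftrightarrow>
      complex_algebraic (of_complex_slice_vec K -` V)" if "K \<in> imag_units" for K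
  proof -
    have "V \<inter> slice_vec K = of_complex_slice_vec K ` (of_complex_slice_vec K -` V)"
      by (simp only: image_vimage_eq range_of_complex_slice_vec)
    then have "V \<inter> slice_vec K = of_complex_slice_vec K ` Z \<longleftrightarrow> Z = of_complex_slice_vec K -` V" for Z
      using inj_image_eq_iff[OF inj_of_complex_slice_vec[OF that]] by metis
    then show ?thesis
      by (simp add: slice_vec_algebraic_def flip: of_complex_slice_vec_def)
  qed
  then show ?thesis
    by (simp add: slice_algebraic_def)
qed

lemma slice_algebraic_empty: "slice_algebraic {}"
  by (simp add: slice_algebraic_iff_vimage complex_algebraic_empty)

lemma slice_algebraic_Un:
  "slice_algebraic V \<Longrightarrow> slice_algebraic W \<Longrightarrow> slice_algebraic (V \<union> W)"
  by (simp add: slice_algebraic_iff_vimage vimage_Un complex_algebraic_Un)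

lemma slice_algebraic_Inter:
  assumes "\<And>V. V \<in> \<F> \<Longrightarrow> slice_algebraic V"
  shows "slice_algebraic (\<Inter>\<F>)"
proof -
  have "of_complex_slice_vec K -` \<Inter>\<F> = \<Inter>((-`) (of_complex_slice_vec K) ` \<F>)" for K
    by auto
  then show ?thesis
    using assms unfolding slice_algebraic_iff_vimage
    by (auto intro!: complex_algebraic_Inter)
qed

theorem proposition4p5:
  shows "\<exists>T :: (quat ^ 'n::finite) topology.
    topspace T = UNIV \<and> (\<forall>V. closedin T V \<longleftrightarrow> slice_algebraic V)"
proof -
  define T :: "(quat ^ 'n) topology" where "T = topology (\<lambda>U. slice_algebraic (- U))"
  \<comment> \<open>De Morgan turns the axioms for open sets into closure under binary unions and
    arbitrary intersections.\<close>
  have "istopology (\<lambda>U :: (quat ^ 'n) set. slice_algebraic (- U))"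
    unfolding istopology_def Compl_Int uminus_Sup
    by (blast intro: slice_algebraic_Un slice_algebraic_Inter)
  then have openin: "openin T U \<longleftrightarrow> slice_algebraic (- U)" for U
    by (simp add: T_def topology_inverse')
  \<comment> \<open>The whole space is open because its complement, the empty set, is slice
    algebraic.\<close>
  have "topspace T = UNIV"
    using openin_subset[of T UNIV] slice_algebraic_empty by (auto simp: openin)
  then show ?thesis
    by (intro exI[of _ T]) (simp add: closedin_def openin flip: Compl_eq_Diff_UNIV)
qed

end
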